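(* Let $G$ be a critical graph with $m$ edges. Then for all integers $t \geq 3m$, the graph $G \vee K_t$ is strongly critical.
   Context: All graphs are finite and simple. For an integer $k \geq 1$, a graph $G$ is $k$-critical if $\chi(G) = k$ and $\chi(G') < k$ for every proper subgraph $G'$ of $G$; $G$ is critical if it is $k$-critical for some $k \geq 1$. The join $G \vee H$ of graphs $G$ and $H$ is obtained from vertex-disjoint copies of $G$ and $H$ by making every vertex of $G$ adjacent to every vertex of $H$. $K_t$ is the complete graph on $t$ vertices. A list assignment $L$ for $G$ assigns a set $L(v)$ of colors to each $v \in V(G)$; it is a $q$-assignment if $|L(v)| = q$ for all $v$. A proper $L$-coloring is a choice of $f(v) \in L(v)$ for every $v \in V(G)$ such that adjacent vertices receive different colors. $G$ is $L$-colorable if a proper $L$-coloring exists; otherwise $L$ is bad for $G$. A $q$-assignment is constant if it assigns the same $q$-element set to every vertex. For $k \geq 1$, a graph $G$ is strongly $k$-critical if $G$ is $k$-critical and every bad $(k-1)$-assignment for $G$ is constant. $G$ is strongly critical if it is strongly $k$-critical for some $k \geq 1$. *)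

theory Defs
  imports "Graph_Theory.Graph_Theory"
begin

text \<open>
  Finite simple graphs are the library's \<^locale>\<open>pair_graph\<close>s: a finite vertex set together
  with a symmetric irreflexive adjacency relation \<^const>\<open>parcs\<close>. The null graph is allowed.
\<close>

text \<open>An edge contributes two pairs to \<^const>\<open>parcs\<close>, so edges are counted as unordered pairs.\<close>

definition num_edges :: "'v pair_pre_digraph \<Rightarrow> nat" where
  "num_edges G = card {{u, v} | u v. (u, v) \<in> parcs G}"

definition complete_graph :: "nat \<Rightarrow> nat pair_pre_digraph" where
  "complete_graph t =
     \<lparr>pverts = {..<t}, parcs = {(i, j). i < t \<and> j < t \<and> i \<noteq> j}\<rparr>"

definition graph_join ::
  "'v pair_pre_digraph \<Rightarrow> 'w pair_pre_digraph \<Rightarrow> ('v + 'w) pair_pre_digraph" where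
  "graph_join G H =
     \<lparr>pverts = pverts G <+> pverts H,
      parcs = {(Inl u, Inl v) | u v. (u, v) \<in> parcs G}
            \<union> {(Inr u, Inr v) | u v. (u, v) \<in> parcs H}
            \<union> {(Inl u, Inr v) | u v. u \<in> pverts G \<and> v \<in> pverts H}
            \<union> {(Inr v, Inl u) | u v. u \<in> pverts G \<and> v \<in> pverts H}\<rparr>"

definition proper_coloring :: "'v pair_pre_digraph \<Rightarrow> ('v \<Rightarrow> 'c) \<Rightarrow> bool" where
  "proper_coloring G f \<longleftrightarrow> (\<forall>u v. (u, v) \<in> parcs G \<longrightarrow> f u \<noteq> f v)"

definition chromatic_number :: "'v pair_pre_digraph \<Rightarrow> nat" where
  "chromatic_number G =
     (LEAST k. \<exists>f :: 'v \<Rightarrow> nat. f ` pverts G \<subseteq> {..<k} \<and> proper_coloring G f)"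

definition k_critical :: "nat \<Rightarrow> 'v pair_pre_digraph \<Rightarrow> bool" where
  "k_critical k G \<longleftrightarrow>
     k \<ge> 1 \<and> pair_graph G \<and> chromatic_number G = k \<and>
     (\<forall>H. pair_graph H \<and> subgraph H G \<and> H \<noteq> G \<longrightarrow> chromatic_number H < k)"

definition critical :: "'v pair_pre_digraph \<Rightarrow> bool" where
  "critical G \<longleftrightarrow> (\<exists>k\<ge>1. k_critical k G)"

text \<open>
  A list assignment is a function \<open>L\<close> of which only the values on the vertices matter.
  Finiteness is required explicitly since \<^const>\<open>card\<close> is 0 on infinite sets,
  and \<open>q = 0\<close> does occur (for 1-critical graphs).
\<close>

definition q_assignment :: "nat \<Rightarrow> 'v pair_pre_digraph \<Rightarrow> ('v \<Rightarrow> 'c set) \<Rightarrow> bool" where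
  "q_assignment q G L \<longleftrightarrow> (\<forall>v \<in> pverts G. finite (L v) \<and> card (L v) = q)"

definition L_colorable :: "'v pair_pre_digraph \<Rightarrow> ('v \<Rightarrow> 'c set) \<Rightarrow> bool" where
  "L_colorable G L \<longleftrightarrow> (\<exists>f. (\<forall>v \<in> pverts G. f v \<in> L v) \<and> proper_coloring G f)"

abbreviation bad :: "'v pair_pre_digraph \<Rightarrow> ('v \<Rightarrow> 'c set) \<Rightarrow> bool" where
  "bad G L \<equiv> \<not> L_colorable G L"

definition constant_assignment :: "'v pair_pre_digraph \<Rightarrow> ('v \<Rightarrow> 'c set) \<Rightarrow> bool" where
  "constant_assignment G L \<longleftrightarrow> (\<exists>S. \<forall>v \<in> pverts G. L v = S)"

text \<open>
  The colors are drawn from an arbitrary type \<open>'c\<close>, which occurs only under a quantifier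
  over list assignments and is therefore passed as a type argument. An infinite type such as
  \<^typ>\<open>nat\<close> gives the usual notion, since finite lists on a finite graph
  use only finitely many colors.
\<close>

definition strongly_k_critical :: "'c itself \<Rightarrow> nat \<Rightarrow> 'v pair_pre_digraph \<Rightarrow> bool" where
  "strongly_k_critical (_ :: 'c itself) k G \<longleftrightarrow>
     k \<ge> 1 \<and> k_critical k G \<and>
     (\<forall>L :: 'v \<Rightarrow> 'c set. q_assignment (k - 1) G L \<and> bad G L \<longrightarrow> constant_assignment G L)"

definition strongly_critical :: "'c itself \<Rightarrow> 'v pair_pre_digraph \<Rightarrow> bool" where
  "strongly_critical C G \<longleftrightarrow> (\<exists>k\<ge>1. strongly_k_critical C k G)"

lemma pair_graph_complete_graph: "pair_graph (complete_graph t)"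
proof -
  have "finite (parcs (complete_graph t))"
    by (rule finite_subset[of _ "{..<t} \<times> {..<t}"]) (auto simp: complete_graph_def)
  then show ?thesis
    by unfold_locales (auto simp: complete_graph_def arcs_ends_def arc_to_ends_def
        symmetric_def intro!: symI)
qed

lemma complete_digraph_complete_graph: "complete_digraph t (complete_graph t)"
  using pair_graph.pair_graphD_graph[OF pair_graph_complete_graph[of t]]
  by (auto simp: complete_digraph_def complete_graph_def arcs_ends_def arc_to_ends_def)

lemma pair_graph_graph_join:
  assumes "pair_graph G" "pair_graph H"
  shows "pair_graph (graph_join G H)"
proof -
  interpret G: pair_graph G by fact
  interpret H: pair_graph H by fact
  have G: "u \<in> pverts G" "v \<in> pverts G" "u \<noteq> v" "(v, u) \<in> parcs G" if "(u, v) \<in> parcs G" for u v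
    using that G.arc_fst_in_verts G.arc_snd_in_verts G.pair_no_loops G.pair_sym_arcs
    by (force simp: symmetric_def dest: symD)+
  have H: "u \<in> pverts H" "v \<in> pverts H" "u \<noteq> v" "(v, u) \<in> parcs H" if "(u, v) \<in> parcs H" for u v
    using that H.arc_fst_in_verts H.arc_snd_in_verts H.pair_no_loops H.pair_sym_arcs
    by (force simp: symmetric_def dest: symD)+
  have V: "finite (pverts (graph_join G H))"
    using G.pair_finite_verts H.pair_finite_verts by (simp add: graph_join_def)
  have sub: "parcs (graph_join G H) \<subseteq> pverts (graph_join G H) \<times> pverts (graph_join G H)"
    using G H by (auto simp: graph_join_def)
  have "finite (parcs (graph_join G H))"
    using finite_subset[OF sub] V by simp
  moreover have "sym (parcs (graph_join G H))"
    using G H by (auto simp: graph_join_def intro!: symI)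
  moreover have "fst e \<noteq> snd e" if "e \<in> parcs (graph_join G H)" for e
    using that G H by (auto simp: graph_join_def)
  ultimately show ?thesis
    using V sub by unfold_locales (auto simp: symmetric_def arcs_ends_def arc_to_ends_def)
qed

end

theory Submission
  imports Defs
begin

text \<open>
  Let \<open>G\<close> be \<open>k\<close>-critical and let \<open>L\<close> be a \<open>(k + t - 1)\<close>-assignment for the join that is not
  constant. Color clique vertices one at a time, whenever possible with a color that is missing
  from the list of some vertex \<open>v\<close> of \<open>G\<close>; then \<open>v\<close> gains one color relative to the size of the
  remaining clique. A vertex whose list is larger than its degree in the remaining graph is
  removed and colored at the very end. By the handshake lemma at most \<open>2m\<close> such steps (one if
  \<open>k = 1\<close>) remove all of \<open>G\<close>, so the clique is not exhausted before. If the process gets stuck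
  earlier, every list on the clique is contained in every list on \<open>G\<close>. Then all vertices of \<open>G\<close>
  except possibly one receive \<open>k - 1\<close> colors from the list of a clique vertex \<open>b\<close>, the exceptional
  one receives a color outside that list, and the clique is colored greedily with \<open>b\<close> last.
\<close>

section \<open>List colorings of a join with a clique\<close>

lemma distinct_representatives_greedy:
  assumes "finite A" "\<And>a. a \<in> A \<Longrightarrow> finite (L a) \<and> card A \<le> card (L a)"
  shows "\<exists>g. (\<forall>a\<in>A. g a \<in> L a) \<and> inj_on g A"
  using assms
proof (induction A rule: finite_induct)
  case empty
  then show ?case by simp
next
  case (insert b A)
  then have "\<exists>g. (\<forall>a\<in>A. g a \<in> L a) \<and> inj_on g A"
    by (intro insert.IH) (force simp: card_insert_if)
  then obtain g where g: "\<forall>a\<in>A. g a \<in> L a" "inj_on g A" by blast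
  have "card (g ` A) < card (L b)"
    using insert.prems[of b] insert.hyps card_image_le[of A g] by simp
  then have "\<not> L b \<subseteq> g ` A"
    using card_mono[of "g ` A" "L b"] insert.hyps by auto
  then obtain y where "y \<in> L b" "y \<notin> g ` A" by blast
  with g insert.hyps show ?case
    by (intro exI[of _ "g(b := y)"]) (auto simp: inj_on_def)
qed

text \<open>Serving \<open>b\<close> last means that the greedy choice first handles only
  \<open>card A - 1\<close> vertices, so all lists except that of \<open>b\<close> may be one color
  shorter.\<close>

lemma distinct_representatives_greedy_last:
  assumes "finite A" "b \<in> A"
    and L: "\<And>a. a \<in> A \<Longrightarrow> finite (L a) \<and> card A - 1 \<le> card (L a)"
    and b: "card A \<le> card (L b)"
  shows "\<exists>g. (\<forall>a\<in>A. g a \<in> L a) \<and> inj_on g A"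
proof -
  have "\<exists>g. (\<forall>a\<in>A - {b}. g a \<in> L a) \<and> inj_on g (A - {b})"
    using assms by (intro distinct_representatives_greedy) auto
  then obtain g where g: "\<forall>a\<in>A - {b}. g a \<in> L a" "inj_on g (A - {b})" by blast
  have "card (g ` (A - {b})) \<le> card (A - {b})"
    using assms by (intro card_image_le) auto
  also have "\<dots> < card (L b)"
    using assms by (metis card_Diff1_less order_less_le_trans)
  finally have "\<not> L b \<subseteq> g ` (A - {b})"
    using card_mono[of "g ` (A - {b})" "L b"] assms(1) by auto
  then obtain y where "y \<in> L b" "y \<notin> g ` (A - {b})" by blast
  with g show ?thesis
    by (intro exI[of _ "g(b := y)"]) (auto simp: inj_on_def)
qed

text \<open>The vertex set is kept apart from the edge relation, and pairs of \<open>E\<close> that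
  leave \<open>W\<close> are ignored. Deleting a vertex therefore changes \<open>W\<close>
  alone.\<close>

definition colorable_on :: "('v \<times> 'v) set \<Rightarrow> 'v set \<Rightarrow> nat \<Rightarrow> bool" where
  "colorable_on E W r \<longleftrightarrow>
     (\<exists>h :: 'v \<Rightarrow> nat. h ` W \<subseteq> {..<r} \<and> (\<forall>u\<in>W. \<forall>v\<in>W. (u, v) \<in> E \<longrightarrow> h u \<noteq> h v))"

lemma colorable_on_mono:
  assumes "colorable_on E W r" "E' \<subseteq> E" "W' \<subseteq> W" "r \<le> r'"
  shows "colorable_on E' W' r'"
proof -
  obtain h :: "'a \<Rightarrow> nat" where h: "h ` W \<subseteq> {..<r}"
    "\<forall>u\<in>W. \<forall>v\<in>W. (u, v) \<in> E \<longrightarrow> h u \<noteq> h v"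
    using assms(1) by (auto simp: colorable_on_def)
  have "h ` W' \<subseteq> {..<r'}" using h(1) assms(3,4) by fastforce
  moreover have "\<forall>u\<in>W'. \<forall>v\<in>W'. (u, v) \<in> E' \<longrightarrow> h u \<noteq> h v" using h(2) assms(2,3) by blast
  ultimately show ?thesis by (auto simp: colorable_on_def)
qed

lemma colorable_onI:
  assumes "finite S" "card S \<le> r" "f ` W \<subseteq> S"
    and "\<And>u v. u \<in> W \<Longrightarrow> v \<in> W \<Longrightarrow> (u, v) \<in> E \<Longrightarrow> f u \<noteq> f v"
  shows "colorable_on E W r"
proof -
  obtain e where e: "bij_betw e S {..<card S}"
    using ex_bij_betw_finite_nat[OF assms(1)] by (auto simp: atLeast0LessThan)
  then have "e (f u) < r" if "u \<in> W" for u
    using bij_betwE[OF e] that assms(2,3) by fastforce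
  moreover have "e (f u) \<noteq> e (f v)" if "u \<in> W" "v \<in> W" "(u, v) \<in> E" for u v
    using that assms(3,4) bij_betw_imp_inj_on[OF e] by (metis image_subset_iff inj_onD)
  ultimately show ?thesis
    unfolding colorable_on_def by (intro exI[of _ "e \<circ> f"]) auto
qed

lemma colorable_on_colors:
  assumes "colorable_on E W r" "finite S" "card S = r"
  obtains h where "h ` W \<subseteq> S" "\<And>u v. u \<in> W \<Longrightarrow> v \<in> W \<Longrightarrow> (u, v) \<in> E \<Longrightarrow> h u \<noteq> h v"
proof -
  obtain h :: "'a \<Rightarrow> nat" where h: "h ` W \<subseteq> {..<r}"
    "\<forall>u\<in>W. \<forall>v\<in>W. (u, v) \<in> E \<longrightarrow> h u \<noteq> h v"
    using assms(1) by (auto simp: colorable_on_def)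
  obtain e where e: "bij_betw e {..<r} S"
    using ex_bij_betw_nat_finite[OF assms(2)] assms(3) by (auto simp: atLeast0LessThan)
  show ?thesis
  proof
    show "(e \<circ> h) ` W \<subseteq> S"
      using h(1) e by (auto simp: bij_betw_def)
    show "(e \<circ> h) u \<noteq> (e \<circ> h) v" if "u \<in> W" "v \<in> W" "(u, v) \<in> E" for u v
      using h that bij_betw_imp_inj_on[OF e] by (metis comp_apply image_subset_iff inj_onD)
  qed
qed

text \<open>Colorings of the join of the graph \<open>(W, E)\<close> with the complete graph on \<open>A\<close>.\<close>

definition join_list_colorable ::
  "('v \<times> 'v) set \<Rightarrow> 'v set \<Rightarrow> ('v \<Rightarrow> 'c set) \<Rightarrow> 'w set \<Rightarrow> ('w \<Rightarrow> 'c set) \<Rightarrow> bool" where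
  "join_list_colorable E W P A Q \<longleftrightarrow>
     (\<exists>f g. (\<forall>v\<in>W. f v \<in> P v) \<and> (\<forall>u\<in>W. \<forall>v\<in>W. (u, v) \<in> E \<longrightarrow> f u \<noteq> f v) \<and>
        (\<forall>a\<in>A. g a \<in> Q a) \<and> inj_on g A \<and> f ` W \<inter> g ` A = {})"

text \<open>If \<open>v\<close> is colored last, its neighbors in \<open>W\<close> and the clique
  together block fewer colors than \<open>P v\<close> contains.\<close>

lemma join_list_colorable_insert_vertex:
  assumes "finite W" "finite A" "sym E" "irrefl E" "v \<in> W"
    and big: "card {u \<in> W. (v, u) \<in> E} + card A < card (P v)"
    and col: "join_list_colorable E (W - {v}) P A Q"
  shows "join_list_colorable E W P A Q"
proof -
  obtain f g where fg: "\<forall>v\<in>W - {v}. f v \<in> P v"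
    "\<forall>u\<in>W - {v}. \<forall>w\<in>W - {v}. (u, w) \<in> E \<longrightarrow> f u \<noteq> f w"
    "\<forall>a\<in>A. g a \<in> Q a" "inj_on g A" "f ` (W - {v}) \<inter> g ` A = {}"
    using col by (auto simp: join_list_colorable_def)
  let ?B = "f ` {u \<in> W. (v, u) \<in> E} \<union> g ` A"
  have "card ?B \<le> card (f ` {u \<in> W. (v, u) \<in> E}) + card (g ` A)"
    by (rule card_Un_le)
  also have "\<dots> \<le> card {u \<in> W. (v, u) \<in> E} + card A"
    using assms by (intro add_mono card_image_le) auto
  finally have "\<not> P v \<subseteq> ?B"
    using card_mono[of ?B "P v"] big assms by auto
  then obtain y where y: "y \<in> P v" "y \<notin> ?B" by blast
  have E: "(u, v) \<in> E \<Longrightarrow> (v, u) \<in> E" "(v, v) \<notin> E" for u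
    using assms by (auto simp: sym_def irrefl_def)
  show ?thesis
    unfolding join_list_colorable_def
    by (intro exI[of _ "f(v := y)"] exI[of _ g]) (use fg y E in \<open>auto split: if_splits\<close>)
qed

text \<open>This is one step of the process: \<open>a\<close> receives \<open>c\<close>, and
  \<open>c\<close> disappears from all other lists. The new lists are only required to be contained
  in what remains, which leaves room for trimming them to a prescribed size.\<close>

lemma join_list_colorable_insert_clique:
  assumes a: "a \<in> A" "c \<in> Q a"
    and P: "\<And>v. v \<in> W \<Longrightarrow> P' v \<subseteq> P v - {c}"
    and Q: "\<And>b. b \<in> A - {a} \<Longrightarrow> Q' b \<subseteq> Q b - {c}"
    and col: "join_list_colorable E W P' (A - {a}) Q'"
  shows "join_list_colorable E W P A Q"
proof -
  obtain f g where fg: "\<forall>v\<in>W. f v \<in> P' v" "\<forall>u\<in>W. \<forall>w\<in>W. (u, w) \<in> E \<longrightarrow> f u \<noteq> f w"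
    "\<forall>b\<in>A - {a}. g b \<in> Q' b" "inj_on g (A - {a})" "f ` W \<inter> g ` (A - {a}) = {}"
    using col by (auto simp: join_list_colorable_def)
  show ?thesis
    unfolding join_list_colorable_def
  proof (intro exI[of _ f] exI[of _ "g(a := c)"] conjI)
    show "\<forall>v\<in>W. f v \<in> P v" using fg(1) P by blast
    show "\<forall>b\<in>A. (g(a := c)) b \<in> Q b" using fg(3) Q a by auto
    show "inj_on (g(a := c)) A" using fg(3,4) Q by (fastforce simp: inj_on_def)
    have "c \<notin> f ` W" using fg(1) P by blast
    then show "f ` W \<inter> (g(a := c)) ` A = {}" using fg(5) by auto
  qed (use fg in auto)
qed

text \<open>
  If \<open>r\<close> colors do not suffice for \<open>W\<close>, then \<open>v\<close> gets a color of \<open>P v - Q b\<close> and \<open>W - {v}\<close> gets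
  \<open>r\<close> colors of \<open>Q b\<close>. Every other clique vertex may lose \<open>r + 1\<close> colors, but \<open>b\<close> loses only \<open>r\<close>.
\<close>

lemma join_list_colorable_nested:
  assumes "finite A" "A \<noteq> {}"
    and Q: "\<And>a. a \<in> A \<Longrightarrow> finite (Q a) \<and> card (Q a) = r + card A"
    and sub: "\<And>a v. a \<in> A \<Longrightarrow> v \<in> W \<Longrightarrow> Q a \<subseteq> P v"
    and crit: "\<And>v. v \<in> W \<Longrightarrow> colorable_on E (W - {v}) r"
    and nc: "colorable_on E W r \<or> (\<exists>v\<in>W. \<exists>b\<in>A. P v \<noteq> Q b)"
    and E: "sym E" "irrefl E"
  shows "join_list_colorable E W P A Q"
proof -
  \<comment> \<open>\<open>F\<close> holds the colors forbidden to the clique once \<open>W\<close>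
    is colored. The last two bounds are exactly what the greedy choice with \<open>b\<close> last
    can afford.\<close>
  obtain b f F where b: "b \<in> A" and f: "\<forall>v\<in>W. f v \<in> P v"
      "\<forall>u\<in>W. \<forall>v\<in>W. (u, v) \<in> E \<longrightarrow> f u \<noteq> f v"
    and F: "finite F" "f ` W \<subseteq> F" "card F \<le> r + 1" "card (Q b \<inter> F) \<le> r"
  proof (cases "colorable_on E W r")
    case True
    \<comment> \<open>Any clique vertex serves: \<open>r\<close> colors of \<open>Q b\<close> lie in
      every list on \<open>W\<close>, and no exceptional vertex is needed.\<close>
    obtain b where b: "b \<in> A" using assms by blast
    obtain S where S: "S \<subseteq> Q b" "card S = r" "finite S"
      using obtain_subset_with_card_n[of r "Q b"] Q[OF b] by (metis le_add1)
    obtain f where f: "f ` W \<subseteq> S" "\<And>u v. u \<in> W \<Longrightarrow> v \<in> W \<Longrightarrow> (u, v) \<in> E \<Longrightarrow> f u \<noteq> f v"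
      using colorable_on_colors[OF True S(3,2)] by blast
    show ?thesis
    proof (rule that)
      show "\<forall>v\<in>W. f v \<in> P v" using f(1) S(1) sub[OF b] by blast
      show "card (Q b \<inter> S) \<le> r" using S by (simp add: Int_absorb1)
    qed (use b f S in auto)
  next
    case False
    then obtain v b where vb: "v \<in> W" "b \<in> A" "P v \<noteq> Q b" using nc by blast
    then obtain x where x: "x \<in> P v" "x \<notin> Q b" using sub by blast
    obtain S where S: "S \<subseteq> Q b" "card S = r" "finite S"
      using obtain_subset_with_card_n[of r "Q b"] Q[OF vb(2)] by (metis le_add1)
    obtain f where f: "f ` (W - {v}) \<subseteq> S"
      "\<And>u w. u \<in> W - {v} \<Longrightarrow> w \<in> W - {v} \<Longrightarrow> (u, w) \<in> E \<Longrightarrow> f u \<noteq> f w"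
      using colorable_on_colors[OF crit[OF vb(1)] S(3,2)] by blast
    have ne: "f u \<noteq> x" if "u \<in> W" "u \<noteq> v" for u
      using f(1) S(1) x that by blast
    have f_in: "f u \<in> P u" if "u \<in> W" "u \<noteq> v" for u
      using f(1) S(1) sub[OF vb(2)] that by blast
    have "(v, v) \<notin> E" using E by (auto simp: irrefl_def)
    \<comment> \<open>The extra color \<open>x\<close> costs \<open>b\<close> nothing, so
      \<open>b\<close> loses only the \<open>r\<close> colors of \<open>S\<close>.\<close>
    moreover have "Q b \<inter> insert x S = S" using x S by auto
    ultimately show ?thesis
      using vb(1,2) f ne S x f_in
      by (intro that[of b "f(v := x)" "insert x S"]) (auto simp: card_insert_if)
  qed
  have "\<exists>g. (\<forall>a\<in>A. g a \<in> Q a - F) \<and> inj_on g A"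
  proof (rule distinct_representatives_greedy_last[OF assms(1) b])
    show "finite (Q a - F) \<and> card A - 1 \<le> card (Q a - F)" if "a \<in> A" for a
      using Q[OF that] diff_card_le_card_Diff[OF F(1), of "Q a"] F(3) by auto
    show "card A \<le> card (Q b - F)"
      using Q[OF b] F(1,4) card_Diff_subset_Int[of "Q b" F] by auto
  qed
  then obtain g where "\<forall>a\<in>A. g a \<in> Q a - F" "inj_on g A" by blast
  moreover from this have "f ` W \<inter> g ` A = {}" using F(2) by auto
  ultimately show ?thesis
    using f unfolding join_list_colorable_def
    by (intro exI[of _ f] exI[of _ g]) simp
qed

text \<open>
  Coloring a clique vertex with a color missing from some list on \<open>W\<close> lowers the
  potential, the left-hand side of \<open>pot\<close>, by at least one. A summand equal to 0 means that
  the vertex can be colored last.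
\<close>

lemma join_list_colorable_potential:
  assumes "finite W" "finite A" "sym E" "irrefl E"
    and "\<And>a. a \<in> A \<Longrightarrow> finite (Q a) \<and> card (Q a) = r + card A"
    and "\<And>v. v \<in> W \<Longrightarrow> finite (P v) \<and> r + card A \<le> card (P v)"
    and "\<And>v. v \<in> W \<Longrightarrow> colorable_on E (W - {v}) r"
    and "colorable_on E W r \<or> A = {} \<or> (\<exists>v\<in>W. \<exists>b\<in>A. P v \<noteq> Q b)"
    and pot: "(\<Sum>v\<in>W. card {u \<in> W. (v, u) \<in> E} + card A + 1 - card (P v)) \<le> card A"
  shows "join_list_colorable E W P A Q"
  using assms
proof (induction "card W + card A" arbitrary: W A P Q rule: less_induct)
  case less
  note fin = less.prems(1,2) and E = less.prems(3,4) and Q = less.prems(5)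
    and P = less.prems(6) and crit = less.prems(7) and nc = less.prems(8)
    and pot = less.prems(9)
  consider (drop) v where "v \<in> W" "card {u \<in> W. (v, u) \<in> E} + card A < card (P v)"
    | (nested) "A \<noteq> {}" "\<And>a v. a \<in> A \<Longrightarrow> v \<in> W \<Longrightarrow> Q a \<subseteq> P v"
    | (empty) "A = {}" "\<And>v. v \<in> W \<Longrightarrow> card (P v) \<le> card {u \<in> W. (v, u) \<in> E} + card A"
    | (save) a v c where "a \<in> A" "v \<in> W" "c \<in> Q a" "c \<notin> P v"
        "\<And>v. v \<in> W \<Longrightarrow> card (P v) \<le> card {u \<in> W. (v, u) \<in> E} + card A"
    by (meson not_le subsetI)
  then show ?case
  proof cases
    case drop
    \<comment> \<open>After the removal of \<open>v\<close> the rest of \<open>W\<close> is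
      \<open>r\<close>-colorable by \<open>crit\<close>, so the disjunction \<open>nc\<close> holds
      for it through its first alternative.\<close>
    have "join_list_colorable E (W - {v}) P A Q"
    proof (rule less.hyps)
      show "card (W - {v}) + card A < card W + card A"
        using card_Diff1_less[OF fin(1) drop(1)] by simp
      show "colorable_on E (W - {v} - {w}) r" if "w \<in> W - {v}" for w
        using crit[of w] that by (auto intro: colorable_on_mono)
      have "(\<Sum>w\<in>W - {v}. card {u \<in> W - {v}. (w, u) \<in> E} + card A + 1 - card (P w))
          \<le> (\<Sum>w\<in>W - {v}. card {u \<in> W. (w, u) \<in> E} + card A + 1 - card (P w))"
        using fin by (intro sum_mono diff_le_mono add_mono card_mono) auto
      also have "\<dots> \<le> (\<Sum>w\<in>W. card {u \<in> W. (w, u) \<in> E} + card A + 1 - card (P w))"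
        using fin by (intro sum_mono2) auto
      finally show "(\<Sum>w\<in>W - {v}. card {u \<in> W - {v}. (w, u) \<in> E} + card A + 1 - card (P w))
          \<le> card A"
        using pot by simp
    qed (use fin E Q P crit[OF drop(1)] in auto)
    then show ?thesis
      by (rule join_list_colorable_insert_vertex[OF fin E drop(1), where P = P, OF drop(2)])
  next
    case nested
    show ?thesis
      by (rule join_list_colorable_nested) (use fin E Q crit nc nested in blast)+
  next
    case empty
    \<comment> \<open>With no clique left \<open>pot\<close> bounds the sum by 0, while each vertex
      that cannot be dropped contributes at least 1.\<close>
    then have "W = {}"
      using pot fin by fastforce
    with empty show ?thesis by (simp add: join_list_colorable_def)
  next
    case save
    have cA: "card (A - {a}) = card A - 1" "card A > 0"
      using save fin by (auto simp: card_gt_0_iff)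
    \<comment> \<open>A list that did not contain \<open>c\<close> is now one color too long. It is
      trimmed, because the induction hypothesis asks for clique lists of exact size.\<close>
    have "\<exists>T. T \<subseteq> Q b - {c} \<and> finite T \<and> card T = r + card (A - {a})" if "b \<in> A" for b
    proof -
      have "r + card (A - {a}) \<le> card (Q b - {c})"
        using Q[OF that] cA diff_card_le_card_Diff[of "{c}" "Q b"] by auto
      then show ?thesis by (metis obtain_subset_with_card_n)
    qed
    then obtain Q' where Q': "\<And>b. b \<in> A \<Longrightarrow> Q' b \<subseteq> Q b - {c}"
      "\<And>b. b \<in> A \<Longrightarrow> finite (Q' b) \<and> card (Q' b) = r + card (A - {a})"
      by metis
    define P' where "P' w = P w - {c}" for w
    have P': "card (P w) - 1 \<le> card (P' w)" for w
      using diff_card_le_card_Diff[of "{c}" "P w"] by (simp add: P'_def)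
    have P'v: "P' v = P v" using save by (simp add: P'_def)
    have "join_list_colorable E W P' (A - {a}) Q'"
    proof (rule less.hyps)
      show "card W + card (A - {a}) < card W + card A" using cA by simp
      show "finite (P' w) \<and> r + card (A - {a}) \<le> card (P' w)" if "w \<in> W" for w
        using P[OF that] P'[of w] cA by (auto simp: P'_def)
      \<comment> \<open>The sizes differ: \<open>P' v\<close> still has at least
        \<open>r + card A\<close> colors, and \<open>Q' b\<close> has one fewer than that number. So
        \<open>nc\<close> survives the step.\<close>
      have "P' v \<noteq> Q' b" if "b \<in> A" for b
        using Q'(2)[OF that] P[OF save(2)] cA by (auto simp: P'v)
      then show "colorable_on E W r \<or> A - {a} = {} \<or> (\<exists>v\<in>W. \<exists>b\<in>A - {a}. P' v \<noteq> Q' b)"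
        using save(2) by (metis DiffD1 ex_in_conv)
      have "(\<Sum>w\<in>W. card {u \<in> W. (w, u) \<in> E} + card (A - {a}) + 1 - card (P' w))
          < (\<Sum>w\<in>W. card {u \<in> W. (w, u) \<in> E} + card A + 1 - card (P w))"
      proof (rule sum_strict_mono_ex1[OF fin(1)])
        show "\<forall>w\<in>W. card {u \<in> W. (w, u) \<in> E} + card (A - {a}) + 1 - card (P' w)
            \<le> card {u \<in> W. (w, u) \<in> E} + card A + 1 - card (P w)"
        proof
          fix w
          show "card {u \<in> W. (w, u) \<in> E} + card (A - {a}) + 1 - card (P' w)
              \<le> card {u \<in> W. (w, u) \<in> E} + card A + 1 - card (P w)"
            using P'[of w] cA by linarith
        qed
        \<comment> \<open>The strict decrease occurs at \<open>v\<close>, whose list stays intact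
          while the clique shrinks. Since \<open>v\<close> cannot be dropped, its old summand is
          positive, so truncated subtraction does not hide the decrease.\<close>
        show "\<exists>w\<in>W. card {u \<in> W. (w, u) \<in> E} + card (A - {a}) + 1 - card (P' w)
            < card {u \<in> W. (w, u) \<in> E} + card A + 1 - card (P w)"
          using save(2) save(5)[OF save(2)] cA by (intro bexI[of _ v]) (auto simp: P'v)
      qed
      then show "(\<Sum>w\<in>W. card {u \<in> W. (w, u) \<in> E} + card (A - {a}) + 1 - card (P' w))
          \<le> card (A - {a})"
        using pot cA by simp
    qed (use fin E Q' crit in auto)
    then show ?thesis
      using join_list_colorable_insert_clique[of a A c Q W P' P Q' E] save Q'(1)
      by (simp add: P'_def)
  qed
qed

section \<open>Criticality of the join\<close>

lemma pair_graph_facts: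
  assumes "pair_graph G"
  shows "finite (pverts G)" "finite (parcs G)" "sym (parcs G)" "irrefl (parcs G)"
    and "parcs G \<subseteq> pverts G \<times> pverts G"
proof -
  interpret pair_graph G by fact
  show "finite (pverts G)" "finite (parcs G)" by auto
  show "parcs G \<subseteq> pverts G \<times> pverts G"
    using in_arcsD1 in_arcsD2 by auto
  show "sym (parcs G)"
    using pair_sym_arcs by (simp add: symmetric_def)
  show "irrefl (parcs G)"
    using pair_no_loops by (force simp: irrefl_def)
qed

lemma pair_graphI:
  assumes "finite (pverts G)" "sym (parcs G)" "irrefl (parcs G)"
    and "parcs G \<subseteq> pverts G \<times> pverts G"
  shows "pair_graph G"
proof -
  have "finite (parcs G)"
    using assms(1,4) by (meson finite_SigmaI finite_subset)
  then show ?thesis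
    using assms
    by unfold_locales (auto simp: symmetric_def arcs_ends_def arc_to_ends_def irrefl_def)
qed

lemma subgraph_pair_graph_iff:
  assumes "pair_graph H" "pair_graph G"
  shows "subgraph (with_proj H) (with_proj G) \<longleftrightarrow>
    pverts H \<subseteq> pverts G \<and> parcs H \<subseteq> parcs G"
proof -
  interpret H: pair_graph H by fact
  interpret G: pair_graph G by fact
  show ?thesis
    using H.wf_digraph_axioms G.wf_digraph_axioms by (auto simp: subgraph_def compatible_def)
qed

lemma chromatic_number_le_iff:
  assumes "pair_graph G"
  shows "chromatic_number G \<le> q \<longleftrightarrow> colorable_on (parcs G) (pverts G) q"
proof -
  note G = pair_graph_facts[OF assms]
  have "(\<exists>f. f ` pverts G \<subseteq> {..<k} \<and> proper_coloring G f)
      \<longleftrightarrow> colorable_on (parcs G) (pverts G) k" for k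
  proof -
    have "proper_coloring G f \<longleftrightarrow>
        (\<forall>u\<in>pverts G. \<forall>v\<in>pverts G. (u, v) \<in> parcs G \<longrightarrow> f u \<noteq> f v)" for f :: "'a \<Rightarrow> nat"
      using G(5) unfolding proper_coloring_def by blast
    then show ?thesis unfolding colorable_on_def by simp
  qed
  then have eq: "chromatic_number G = (LEAST k. colorable_on (parcs G) (pverts G) k)"
    by (simp add: chromatic_number_def)
  \<comment> \<open>Giving every vertex its own color shows that the \<open>LEAST\<close> ranges
    over a nonempty set.\<close>
  have "colorable_on (parcs G) (pverts G) (card (pverts G))"
    by (rule colorable_onI[of "pverts G" _ "\<lambda>v. v"]) (use G in \<open>auto simp: irrefl_def\<close>)
  then have "colorable_on (parcs G) (pverts G) (chromatic_number G)"
    unfolding eq by (rule LeastI)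
  then show ?thesis
    using colorable_on_mono eq by (metis Least_le order_refl)
qed

text \<open>Only deletions of a single vertex or a single edge have to be tested: every proper
  subgraph is contained in one of these, and colorability passes to subgraphs.\<close>

lemma k_critical_iff:
  assumes "pair_graph G"
  shows "k_critical k G \<longleftrightarrow>
    k \<ge> 1 \<and> \<not> colorable_on (parcs G) (pverts G) (k - 1) \<and>
    (\<forall>v\<in>pverts G. colorable_on (parcs G) (pverts G - {v}) (k - 1)) \<and>
    (\<forall>(u, v)\<in>parcs G. colorable_on (parcs G - {(u, v), (v, u)}) (pverts G) (k - 1))"
    (is "_ \<longleftrightarrow> _ \<and> ?notcol \<and> ?vert \<and> ?edge")
proof
  note G = pair_graph_facts[OF assms]
  note sub = subgraph_pair_graph_iff[OF _ assms]
  {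
    assume *: "k_critical k G"
    then have k: "k \<ge> 1" "chromatic_number G = k" by (auto simp: k_critical_def)
    have col: "colorable_on (parcs H) (pverts H) (k - 1)"
      if "pair_graph H" "pverts H \<subseteq> pverts G" "parcs H \<subseteq> parcs G" "H \<noteq> G" for H
      using * that sub[of H] chromatic_number_le_iff[of H "k - 1"]
      by (force simp: k_critical_def)
    have "?notcol" using chromatic_number_le_iff[OF assms, of "k - 1"] k by linarith
    moreover have ?vert
    proof
      fix v assume v: "v \<in> pverts G"
      let ?H = "\<lparr>pverts = pverts G - {v}, parcs = {(x, y) \<in> parcs G. x \<noteq> v \<and> y \<noteq> v}\<rparr>"
      have "pair_graph ?H"
        by (rule pair_graphI) (use G in \<open>auto simp: sym_def irrefl_def\<close>)
      moreover have "?H \<noteq> G"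
      proof
        assume "?H = G"
        then have "pverts ?H = pverts G" by (rule arg_cong)
        with v show False by auto
      qed
      ultimately have "colorable_on (parcs ?H) (pverts ?H) (k - 1)"
        by (intro col) auto
      then show "colorable_on (parcs G) (pverts G - {v}) (k - 1)"
        by (auto simp: colorable_on_def)
    qed
    moreover have ?edge
    proof clarify
      fix u v assume uv: "(u, v) \<in> parcs G"
      let ?H = "\<lparr>pverts = pverts G, parcs = parcs G - {(u, v), (v, u)}\<rparr>"
      have "pair_graph ?H"
        by (rule pair_graphI) (use G in \<open>auto simp: sym_def irrefl_def\<close>)
      moreover have "?H \<noteq> G"
      proof
        assume "?H = G"
        then have "parcs ?H = parcs G" by (rule arg_cong)
        with uv show False by auto
      qed
      ultimately have "colorable_on (parcs ?H) (pverts ?H) (k - 1)"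
        by (intro col) auto
      then show "colorable_on (parcs G - {(u, v), (v, u)}) (pverts G) (k - 1)"
        by simp
    qed
    ultimately show "k \<ge> 1 \<and> ?notcol \<and> ?vert \<and> ?edge" using k by blast
  next
    assume *: "k \<ge> 1 \<and> ?notcol \<and> ?vert \<and> ?edge"
    then have "pverts G \<noteq> {}" by (auto simp: colorable_on_def)
    then obtain v where v: "v \<in> pverts G" by blast
    \<comment> \<open>Adding the fresh color \<open>k - 1\<close> at \<open>v\<close> to a coloring
      of the rest gives the upper bound \<open>k\<close> on the chromatic number.\<close>
    then have "colorable_on (parcs G) (pverts G - {v}) (k - 1)" using * by simp
    then obtain h :: "'a \<Rightarrow> nat" where h: "h ` (pverts G - {v}) \<subseteq> {..<k - 1}"
      "\<forall>u\<in>pverts G - {v}. \<forall>w\<in>pverts G - {v}. (u, w) \<in> parcs G \<longrightarrow> h u \<noteq> h w"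
      unfolding colorable_on_def by auto
    have "h u < k - 1" if "u \<in> pverts G" "u \<noteq> v" for u
      using h(1) that by auto
    note h_less = this less_imp_neq[OF this] less_imp_neq[OF this, symmetric] less_imp_le[OF this]
    have "colorable_on (parcs G) (pverts G) k"
    proof (rule colorable_onI[of "{..<k}" _ "h(v := k - 1)"])
      show "(h(v := k - 1)) ` pverts G \<subseteq> {..<k}"
        using h_less(1) * by fastforce
      show "(h(v := k - 1)) u \<noteq> (h(v := k - 1)) w"
        if "u \<in> pverts G" "w \<in> pverts G" "(u, w) \<in> parcs G" for u w
        using that h(2) h_less G(4) by (auto simp: irrefl_def)
    qed auto
    then have "chromatic_number G = k"
      using chromatic_number_le_iff[OF assms, of "k - 1"] chromatic_number_le_iff[OF assms, of k] *
      by auto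
    moreover have "chromatic_number H < k"
      if H: "pair_graph H" "subgraph (with_proj H) (with_proj G)" "H \<noteq> G" for H
    proof -
      have HG: "pverts H \<subseteq> pverts G" "parcs H \<subseteq> parcs G" using sub H by auto
      have "colorable_on (parcs H) (pverts H) (k - 1)"
      proof (cases "pverts H = pverts G")
        case True
        then have "parcs H \<noteq> parcs G" using H(3) by auto
        then obtain u v where uv: "(u, v) \<in> parcs G" "(u, v) \<notin> parcs H" using HG by auto
        \<comment> \<open>By symmetry \<open>H\<close> misses both orientations, hence the whole
          edge.\<close>
        then have "(v, u) \<notin> parcs H" using pair_graph_facts(3)[OF H(1)] by (auto dest: symD)
        then have "parcs H \<subseteq> parcs G - {(u, v), (v, u)}" using uv HG by auto
        moreover have "colorable_on (parcs G - {(u, v), (v, u)}) (pverts G) (k - 1)"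
          using * uv(1) by blast
        ultimately show ?thesis using True by (auto intro: colorable_on_mono)
      next
        case False
        then obtain v where v: "v \<in> pverts G" "pverts H \<subseteq> pverts G - {v}" using HG by auto
        then have "colorable_on (parcs G) (pverts G - {v}) (k - 1)" using * by blast
        then show ?thesis using v HG by (auto intro: colorable_on_mono)
      qed
      then show ?thesis
        using chromatic_number_le_iff[OF H(1), of "k - 1"] * by auto
    qed
    ultimately show "k_critical k G" using * assms by (auto simp: k_critical_def)
  }
qed

text \<open>The colors on \<open>A\<close> are shifted by \<open>p\<close>, so the two palettes are
  disjoint and pairs between the two sides need no condition.\<close>

lemma colorable_on_Plus:
  assumes "colorable_on E\<^sub>1 W p" "colorable_on E\<^sub>2 A q"
    and "\<And>u v. (Inl u, Inl v) \<in> E \<Longrightarrow> (u, v) \<in> E\<^sub>1"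
    and "\<And>u v. (Inr u, Inr v) \<in> E \<Longrightarrow> (u, v) \<in> E\<^sub>2"
  shows "colorable_on E (W <+> A) (p + q)"
proof -
  obtain g :: "'a \<Rightarrow> nat" where g: "g ` W \<subseteq> {..<p}"
    "\<forall>u\<in>W. \<forall>v\<in>W. (u, v) \<in> E\<^sub>1 \<longrightarrow> g u \<noteq> g v"
    using assms(1) by (auto simp: colorable_on_def)
  obtain h :: "'b \<Rightarrow> nat" where h: "h ` A \<subseteq> {..<q}"
    "\<forall>u\<in>A. \<forall>v\<in>A. (u, v) \<in> E\<^sub>2 \<longrightarrow> h u \<noteq> h v"
    using assms(2) by (auto simp: colorable_on_def)
  have "g u \<noteq> p + h a" "p + h a \<noteq> g u" if "u \<in> W" "a \<in> A" for u a
    using g(1) that by (auto simp: image_subset_iff)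
  then show ?thesis
    unfolding colorable_on_def
    by (intro exI[of _ "case_sum g (\<lambda>a. p + h a)"])
      (use g h assms(3,4) in \<open>auto simp: image_subset_iff trans_less_add1\<close>)
qed

text \<open>A deletion inside one factor saves a color there, and the palettes of the factors add
  up. Deleting an edge between the factors lets its two ends share a color.\<close>

lemma k_critical_join_complete:
  assumes crit: "k_critical k G"
  shows "k_critical (k + t) (graph_join G (complete_graph t))"
proof -
  let ?V = "pverts G" and ?E = "parcs G" and ?J = "graph_join G (complete_graph t)"
  let ?K = "parcs (complete_graph t)"
  have pg: "pair_graph G" using crit by (simp add: k_critical_def)
  note G = pair_graph_facts[OF pg]
  have k: "k \<ge> 1" and notcol: "\<not> colorable_on ?E ?V (k - 1)"
    and vert: "\<And>v. v \<in> ?V \<Longrightarrow> colorable_on ?E (?V - {v}) (k - 1)"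
    and edge: "\<And>u v. (u, v) \<in> ?E \<Longrightarrow> colorable_on (?E - {(u, v), (v, u)}) ?V (k - 1)"
    using crit k_critical_iff[OF pg] by auto
  have col: "colorable_on ?E ?V k"
    using crit chromatic_number_le_iff[OF pg, of k] by (auto simp: k_critical_def)
  have colK: "colorable_on ?K {..<t} t"
    by (rule colorable_onI[of "{..<t}" _ "\<lambda>i. i"]) (auto simp: complete_graph_def)
  have VJ: "pverts ?J = ?V <+> {..<t}"
    by (simp add: graph_join_def complete_graph_def)
  have EJ: "(Inl u, Inl v) \<in> parcs ?J \<longleftrightarrow> (u, v) \<in> ?E"
      "(Inr i, Inr j) \<in> parcs ?J \<longleftrightarrow> (i, j) \<in> ?K"
      "(Inl u, Inr i) \<in> parcs ?J \<longleftrightarrow> u \<in> ?V \<and> i < t"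
      "(Inr i, Inl u) \<in> parcs ?J \<longleftrightarrow> u \<in> ?V \<and> i < t" for u v i j
    by (auto simp: graph_join_def complete_graph_def)
  have EK: "(i, j) \<in> ?K \<longleftrightarrow> i < t \<and> j < t \<and> i \<noteq> j" for i j
    by (auto simp: complete_graph_def)
  have kt: "k + t - 1 = (k - 1) + t" using k by simp
  have "\<not> colorable_on (parcs ?J) (pverts ?J) (k + t - 1)"
  proof
    assume "colorable_on (parcs ?J) (pverts ?J) (k + t - 1)"
    then obtain h where h: "h ` pverts ?J \<subseteq> {..<(k - 1) + t}"
      "\<forall>x\<in>pverts ?J. \<forall>y\<in>pverts ?J. (x, y) \<in> parcs ?J \<longrightarrow> h x \<noteq> h y"
      unfolding colorable_on_def kt by blast
    \<comment> \<open>The clique uses up \<open>t\<close> distinct colors, so \<open>G\<close> would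
      be colored with the remaining \<open>k - 1\<close>.\<close>
    let ?T = "(h \<circ> Inr) ` {..<t}"
    have "inj_on (h \<circ> Inr) {..<t}"
      using h(2) by (intro inj_onI) (metis EJ(2) EK InrI VJ comp_apply lessThan_iff)
    then have "card ?T = t" by (metis card_image card_lessThan)
    moreover have "?T \<subseteq> {..<(k - 1) + t}" using h(1) by (auto simp: VJ)
    ultimately have "card ({..<(k - 1) + t} - ?T) = k - 1"
      by (simp add: card_Diff_subset)
    moreover have "h (Inl u) \<noteq> h (Inr i)" if "u \<in> ?V" "i < t" for u i
      using h(2) that by (metis EJ(3) InlI InrI VJ lessThan_iff)
    moreover have "h (Inl u) \<noteq> h (Inl v)" if "u \<in> ?V" "v \<in> ?V" "(u, v) \<in> ?E" for u v
      using h(2) that by (metis EJ(1) InlI VJ)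
    ultimately have "colorable_on ?E ?V (k - 1)"
      using h(1) by (intro colorable_onI[of "{..<(k - 1) + t} - ?T" _ "h \<circ> Inl"])
        (auto simp: VJ image_subset_iff)
    then show False using notcol by simp
  qed
  moreover have "colorable_on (parcs ?J) (pverts ?J - {x}) (k + t - 1)" if "x \<in> pverts ?J" for x
  proof (cases x)
    case (Inl v)
    then have "colorable_on (parcs ?J) ((?V - {v}) <+> {..<t}) ((k - 1) + t)"
      using that by (intro colorable_on_Plus[OF vert colK]) (auto simp: VJ EJ)
    moreover have "pverts ?J - {x} = (?V - {v}) <+> {..<t}" using Inl VJ by auto
    ultimately show ?thesis unfolding kt by simp
  next
    case (Inr i)
    then have i: "i < t" using that VJ by auto
    then have "colorable_on ?K ({..<t} - {i}) (t - 1)"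
      by (intro colorable_onI[of "{..<t} - {i}" _ "\<lambda>i. i"]) (auto simp: EK)
    then have "colorable_on (parcs ?J) (?V <+> ({..<t} - {i})) (k + (t - 1))"
      using that by (intro colorable_on_Plus[OF col]) (auto simp: VJ EJ)
    moreover have "pverts ?J - {x} = ?V <+> ({..<t} - {i})" using Inr VJ by auto
    moreover have "k + t - 1 = k + (t - 1)" using i by simp
    ultimately show ?thesis by simp
  qed
  moreover have "colorable_on (parcs ?J - {(x, y), (y, x)}) (pverts ?J) (k + t - 1)"
    if "(x, y) \<in> parcs ?J" for x y
  proof -
    have cross: "colorable_on (parcs ?J - {(Inl u, Inr i), (Inr i, Inl u)}) (pverts ?J) (k + t - 1)"
      if ui: "u \<in> ?V" "i < t" for u i
    proof -
      obtain h :: "'a \<Rightarrow> nat" where h: "h ` (?V - {u}) \<subseteq> {..<k - 1}"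
        "\<forall>v\<in>?V - {u}. \<forall>w\<in>?V - {u}. (v, w) \<in> ?E \<longrightarrow> h v \<noteq> h w"
        using vert[OF ui(1)] unfolding colorable_on_def by blast
      have h': "h v < k - 1" if "v \<in> ?V" "v \<noteq> u" for v using h(1) that by auto
      then have "h v \<noteq> k - 1 + j" if "v \<in> ?V" "v \<noteq> u" for v j
        using that by fastforce
      note ne = this this[symmetric]
      have uu: "(u, u) \<notin> ?E" using G(4) by (auto simp: irrefl_def)
      \<comment> \<open>The rest of \<open>G\<close> uses the colors below \<open>k - 1\<close>, and
        the clique uses the next \<open>t\<close>. The vertex \<open>u\<close> copies the color of
        \<open>i\<close>, which clashes only along the deleted edge.\<close>
      define f where "f = case_sum (h(u := k - 1 + i)) (\<lambda>j. k - 1 + j)"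
      have "f ` pverts ?J \<subseteq> {..<(k - 1) + t}"
        using ui h' by (auto simp: f_def VJ trans_less_add1)
      moreover have "f x \<noteq> f y"
        if "(x, y) \<in> parcs ?J - {(Inl u, Inr i), (Inr i, Inl u)}" "x \<in> pverts ?J" "y \<in> pverts ?J"
        for x y
      proof (cases x; cases y)
        fix v w assume "x = Inl v" "y = Inl w"
        then show ?thesis
          using that uu ne[of v i] ne[of w i] h(2) by (auto simp: f_def VJ EJ)
      next
        fix v j assume "x = Inl v" "y = Inr j"
        then show ?thesis using that ne[of v j] by (auto simp: f_def VJ)
      next
        fix v j assume "x = Inr j" "y = Inl v"
        then show ?thesis using that ne[of v j] by (auto simp: f_def VJ)
      next
        fix j l assume "x = Inr j" "y = Inr l"
        then show ?thesis using that by (auto simp: f_def EJ EK)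
      qed
      ultimately show ?thesis
        unfolding colorable_on_def kt by blast
    qed
    consider (l) u v where "x = Inl u" "y = Inl v" | (r) i j where "x = Inr i" "y = Inr j"
      | (lr) u i where "x = Inl u" "y = Inr i" | (rl) u i where "x = Inr i" "y = Inl u"
      by (metis sum.exhaust)
    then show ?thesis
    proof cases
      case l
      then show ?thesis
        unfolding VJ kt using that
        by (intro colorable_on_Plus[OF edge[of u v] colK]) (auto simp: EJ)
    next
      case r
      then have ij: "i < t" "j < t" "i \<noteq> j" using that by (auto simp: EJ EK)
      then have "colorable_on (?K - {(i, j), (j, i)}) {..<t} (t - 1)"
        \<comment> \<open>The vertex \<open>j\<close> takes over the color of \<open>i\<close>,
          which frees the color \<open>j\<close>.\<close>
        by (intro colorable_onI[of "{..<t} - {j}" _ "(\<lambda>i. i)(j := i)"]) (auto simp: EK)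
      then have "colorable_on (parcs ?J - {(x, y), (y, x)}) (?V <+> {..<t}) (k + (t - 1))"
        using r by (intro colorable_on_Plus[OF col]) (auto simp: EJ)
      moreover have "k + t - 1 = k + (t - 1)" using ij by simp
      ultimately show ?thesis by (simp add: VJ)
    next
      case lr
      then show ?thesis using that cross[of u i] by (simp add: EJ)
    next
      case rl
      then show ?thesis using that cross[of u i] by (simp add: EJ insert_commute)
    qed
  qed
  ultimately show ?thesis
    using k k_critical_iff[OF pair_graph_graph_join[OF pg pair_graph_complete_graph]]
    by (auto simp: case_prod_unfold)
qed

section \<open>Bad assignments of the join\<close>

text \<open>Handshake lemma: the degrees sum to the number of pairs in \<open>parcs G\<close>, and
  at most two pairs give the same unordered edge.\<close>

lemma sum_degrees_le:
  assumes "pair_graph G"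
  shows "(\<Sum>v\<in>pverts G. card {u \<in> pverts G. (v, u) \<in> parcs G}) \<le> 2 * num_edges G"
proof -
  note G = pair_graph_facts[OF assms]
  let ?D = "{{u, v} | u v. (u, v) \<in> parcs G}"
  have D: "?D = (\<lambda>(u, v). {u, v}) ` parcs G" by auto
  then have fin: "finite ?D" using G by simp
  have fib: "finite {(u, v). {u, v} = e} \<and> card {(u, v). {u, v} = e} \<le> 2" if "e \<in> ?D" for e
  proof -
    obtain a b where "e = {a, b}" using \<open>e \<in> ?D\<close> by blast
    then have sub: "{(u, v). {u, v} = e} \<subseteq> {(a, b), (b, a)}" by (auto simp: doubleton_eq_iff)
    then show ?thesis
      using card_mono[OF _ sub] card_insert_le_m1[of 2 "{(b, a)}" "(a, b)"]
      by (auto intro: finite_subset)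
  qed
  have "(\<Sum>v\<in>pverts G. card {u \<in> pverts G. (v, u) \<in> parcs G})
      = card (SIGMA v:pverts G. {u \<in> pverts G. (v, u) \<in> parcs G})"
    using G by simp
  also have "(SIGMA v:pverts G. {u \<in> pverts G. (v, u) \<in> parcs G}) = parcs G"
    using G(5) by auto
  also have "card (parcs G) \<le> card (\<Union>e\<in>?D. {(u, v). {u, v} = e})"
    using fin fib by (intro card_mono finite_UN_I) auto
  also have "\<dots> \<le> (\<Sum>e\<in>?D. card {(u, v). {u, v} = e})"
    by (rule card_UN_le[OF fin])
  also have "\<dots> \<le> (\<Sum>e\<in>?D. 2)"
    using fib by (intro sum_mono) blast
  finally show ?thesis by (simp add: num_edges_def mult.commute)
qed

text \<open>One color suffices without edges, which forces \<open>k = 1\<close>. Deleting a vertex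
  must then leave a graph colorable with 0 colors, that is, nothing.\<close>

lemma k_critical_edgeless:
  assumes "k_critical k G" "parcs G = {}"
  shows "k = 1 \<and> (\<exists>v. pverts G = {v})"
proof -
  have pg: "pair_graph G" using assms by (simp add: k_critical_def)
  have k: "k \<ge> 1" "\<not> colorable_on {} (pverts G) (k - 1)"
    and vert: "\<And>v. v \<in> pverts G \<Longrightarrow> colorable_on {} (pverts G - {v}) (k - 1)"
    using assms k_critical_iff[OF pg, of k] by auto
  have "colorable_on {} (pverts G) n" if "n > 0" for n
    using that by (auto simp: colorable_on_def intro!: exI[of _ "\<lambda>_. 0"])
  then have "\<not> k - 1 > 0" using k by blast
  then have k1: "k = 1" using k by simp
  have "pverts G \<noteq> {}" using k by (auto simp: colorable_on_def)
  then obtain v where v: "v \<in> pverts G" by blast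
  have "pverts G - {v} = {}" using vert[OF v] k1 by (auto simp: colorable_on_def)
  with v k1 show ?thesis by blast
qed

lemma L_colorable_graph_join_complete:
  assumes "join_list_colorable (parcs G) (pverts G) (L \<circ> Inl) {..<t} (L \<circ> Inr)"
    and "parcs G \<subseteq> pverts G \<times> pverts G"
  shows "L_colorable (graph_join G (complete_graph t)) L"
proof -
  obtain f g where fg: "\<forall>v\<in>pverts G. f v \<in> L (Inl v)"
    "\<forall>u\<in>pverts G. \<forall>v\<in>pverts G. (u, v) \<in> parcs G \<longrightarrow> f u \<noteq> f v"
    "\<forall>a\<in>{..<t}. g a \<in> L (Inr a)" "inj_on g {..<t}" "f ` pverts G \<inter> g ` {..<t} = {}"
    using assms(1) by (auto simp: join_list_colorable_def)
  have "f u \<noteq> g i" "g i \<noteq> f u" if "u \<in> pverts G" "i < t" for u i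
    using fg(5) that by (auto simp: disjoint_iff image_iff)
  then show ?thesis
    unfolding L_colorable_def
    by (intro exI[of _ "case_sum f g"])
      (use fg assms(2) in \<open>auto simp: graph_join_def complete_graph_def proper_coloring_def
        inj_on_def\<close>)
qed

theorem theorem1p4:
  fixes G :: "'v pair_pre_digraph" and m t :: nat
  assumes "critical G"
    and "num_edges G = m"
    and "t \<ge> 3 * m"
  shows "strongly_critical TYPE('c) (graph_join G (complete_graph t))"
proof -
  let ?V = "pverts G" and ?E = "parcs G" and ?J = "graph_join G (complete_graph t)"
  obtain k where k: "k \<ge> 1" "k_critical k G"
    using assms(1) by (auto simp: critical_def)
  then have pg: "pair_graph G" by (simp add: k_critical_def)
  note G = pair_graph_facts[OF pg]
  have notcol: "\<not> colorable_on ?E ?V (k - 1)"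
    and vert: "\<And>v. v \<in> ?V \<Longrightarrow> colorable_on ?E (?V - {v}) (k - 1)"
    using k(2) k_critical_iff[OF pg] by auto
  have ne: "?V \<noteq> {}" using notcol by (auto simp: colorable_on_def)
  \<comment> \<open>These are the degenerate cases: for \<open>t = 0\<close> the join is a single
    vertex, and for \<open>k = 1\<close> the degree sum alone does not bound the potential.\<close>
  have edgeless: "?E = {} \<and> (\<exists>v. ?V = {v})" if "k = 1 \<or> t = 0"
  proof -
    have "?E = {}"
      using that
    proof
      assume "k = 1"
      then have "colorable_on ?E ?V 1"
        using k(2) chromatic_number_le_iff[OF pg, of 1] by (auto simp: k_critical_def)
      then show ?thesis
        using G(5) by (fastforce simp: colorable_on_def image_subset_iff)
    next
      assume "t = 0"
      then have "card {{u, v} | u v. (u, v) \<in> ?E} = 0"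
        using assms(2,3) by (simp add: num_edges_def)
      moreover have "{{u, v} | u v. (u, v) \<in> ?E} = (\<lambda>(u, v). {u, v}) ` ?E" by auto
      ultimately show ?thesis using G(2) by simp
    qed
    then show ?thesis using k_critical_edgeless[OF k(2)] by blast
  qed
  have "constant_assignment ?J L" if L: "q_assignment (k + t - 1) ?J L" "bad ?J L"
    for L :: "'v + nat \<Rightarrow> 'c set"
  proof (cases "t = 0")
    case True
    then show ?thesis
      using edgeless by (auto simp: constant_assignment_def graph_join_def complete_graph_def)
  next
    case False
    have VJ: "pverts ?J = ?V <+> {..<t}"
      by (simp add: graph_join_def complete_graph_def)
    have Lc: "finite (L x) \<and> card (L x) = (k - 1) + t" if "x \<in> ?V <+> {..<t}" for x
      using L(1) that k(1) unfolding q_assignment_def VJ by auto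
    \<comment> \<open>This is the initial potential for \<open>r = k - 1\<close>. A vertex of degree
      \<open>d\<close> contributes \<open>d + 2 - k\<close>: at most \<open>d\<close> if
      \<open>k\<close> is at least 2, and 1 for the single vertex if \<open>k = 1\<close>.\<close>
    have "(\<Sum>v\<in>?V. card {u \<in> ?V. (v, u) \<in> ?E} + card {..<t} + 1 - card ((L \<circ> Inl) v))
        = (\<Sum>v\<in>?V. card {u \<in> ?V. (v, u) \<in> ?E} + 2 - k)"
      using Lc[OF InlI] k(1) by (intro sum.cong) auto
    also have "\<dots> \<le> t"
    proof (cases "k = 1")
      case True
      then obtain v where "?V = {v}" using edgeless by blast
      moreover have "?E = {}" using edgeless True by blast
      ultimately show ?thesis using True \<open>t \<noteq> 0\<close> by simp
    next
      case False
      then have "(\<Sum>v\<in>?V. card {u \<in> ?V. (v, u) \<in> ?E} + 2 - k)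
          \<le> (\<Sum>v\<in>?V. card {u \<in> ?V. (v, u) \<in> ?E})"
        using k(1) by (intro sum_mono) auto
      also have "\<dots> \<le> t" using sum_degrees_le[OF pg] assms(2,3) by linarith
      finally show ?thesis .
    qed
    finally have pot: "(\<Sum>v\<in>?V. card {u \<in> ?V. (v, u) \<in> ?E} + card {..<t} + 1
        - card ((L \<circ> Inl) v)) \<le> card {..<t}" by simp
    have eq: "L (Inl v) = L (Inr b)" if "v \<in> ?V" "b < t" for v b
    proof (rule ccontr)
      assume "L (Inl v) \<noteq> L (Inr b)"
      then have "\<exists>v\<in>?V. \<exists>b\<in>{..<t}. (L \<circ> Inl) v \<noteq> (L \<circ> Inr) b" using that by auto
      then have "join_list_colorable ?E ?V (L \<circ> Inl) {..<t} (L \<circ> Inr)"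
        by (intro join_list_colorable_potential[OF G(1) finite_lessThan G(3,4) _ _ vert _ pot])
          (use Lc[OF InlI] Lc[OF InrI] in auto)
      then show False
        using L(2) L_colorable_graph_join_complete[OF _ G(5)] by blast
    qed
    obtain w where w: "w \<in> ?V" using ne by blast
    \<comment> \<open>Two lists on \<open>G\<close> are compared through a clique vertex, which
      exists because \<open>t\<close> is positive.\<close>
    have "L x = L (Inl w)" if "x \<in> ?V <+> {..<t}" for x
      using that eq w False by (auto; metis not_gr0)
    then show ?thesis
      unfolding constant_assignment_def VJ by blast
  qed
  then show ?thesis
    using k_critical_join_complete[OF k(2), of t] k(1)
    unfolding strongly_critical_def strongly_k_critical_def
    by (intro exI[of _ "k + t"]) auto
qed

end
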